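(* Every $\tau_{\mathbb{Q}}$-continuous function $f:\mathbb{R}\to\mathbb{R}$ is locally almost continuous.
   Context: The topology $\tau_{\mathbb{Q}}$ on $\mathbb{R}$: a set $U\subseteq\mathbb{R}$ is $\tau_{\mathbb{Q}}$-open iff for every $a\in U$ and every real $x\neq0$ there is $\varepsilon(a,x)>0$ such that $a+qx\in U$ for all $q\in\mathbb{Q}$ with $0<q<\varepsilon(a,x)$. A function is $\tau_{\mathbb{Q}}$-continuous if it is continuous from $(\mathbb{R},\tau_{\mathbb{Q}})$ to $\mathbb{R}$ with the usual topology. $f:\mathbb{R}\to\mathbb{R}$ is locally almost continuous if for every $x\in\mathbb{R}$ and every (usual) neighborhood $V$ of $f(x)$ one has $x\in\operatorname{Int}(\overline{f^{-1}(V)})$, with interior and closure taken in the usual topology of $\mathbb{R}$. *)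

theory Defs
  imports "HOL-Analysis.Analysis"
begin

definition tauQ_open :: "real set \<Rightarrow> bool" where
  "tauQ_open U \<longleftrightarrow>
     (\<forall>a\<in>U. \<forall>x. x \<noteq> 0 \<longrightarrow>
        (\<exists>\<epsilon>>0. \<forall>q\<in>\<rat>. 0 < q \<and> q < \<epsilon> \<longrightarrow> a + q * x \<in> U))"

definition tauQ :: "real topology" where
  "tauQ = topology tauQ_open"

lemma istopology_tauQ_open: "istopology tauQ_open"
  unfolding istopology_def
proof (intro conjI allI impI)
  fix S T assume S: "tauQ_open S" and T: "tauQ_open T"
  show "tauQ_open (S \<inter> T)"
    unfolding tauQ_open_def
  proof (intro ballI allI impI)
    fix a x :: real assume a: "a \<in> S \<inter> T" and x: "x \<noteq> 0"
    obtain d where d: "d > 0" "\<forall>q\<in>\<rat>. 0 < q \<and> q < d \<longrightarrow> a + q * x \<in> S"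
      using S a x unfolding tauQ_open_def by blast
    obtain e where e: "e > 0" "\<forall>q\<in>\<rat>. 0 < q \<and> q < e \<longrightarrow> a + q * x \<in> T"
      using T a x unfolding tauQ_open_def by blast
    show "\<exists>\<epsilon>>0. \<forall>q\<in>\<rat>. 0 < q \<and> q < \<epsilon> \<longrightarrow> a + q * x \<in> S \<inter> T"
      using d e by (intro exI[of _ "min d e"]) auto
  qed
next
  fix \<K> assume K: "\<forall>K\<in>\<K>. tauQ_open K"
  show "tauQ_open (\<Union>\<K>)"
    unfolding tauQ_open_def
  proof (intro ballI allI impI)
    fix a x :: real assume "a \<in> \<Union>\<K>" and x: "x \<noteq> 0"
    then obtain K where "K \<in> \<K>" "a \<in> K" by blast
    then show "\<exists>\<epsilon>>0. \<forall>q\<in>\<rat>. 0 < q \<and> q < \<epsilon> \<longrightarrow> a + q * x \<in> \<Union>\<K>"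
      using K x unfolding tauQ_open_def by (meson UnionI)
  qed
qed

lemma openin_tauQ: "openin tauQ U \<longleftrightarrow> tauQ_open U"
  by (simp add: tauQ_def topology_inverse' istopology_tauQ_open)

lemma topspace_tauQ: "topspace tauQ = UNIV"
proof -
  have "tauQ_open UNIV"
    unfolding tauQ_open_def using zero_less_one by blast
  then show ?thesis
    by (metis openin_tauQ openin_subset top.extremum_uniqueI)
qed

abbreviation tauQ_continuous :: "(real \<Rightarrow> real) \<Rightarrow> bool" where
  "tauQ_continuous f \<equiv> continuous_map tauQ euclidean f"

(* A neighbourhood of a point is any set V, not necessarily open, having the point in its interior. *)
definition locally_almost_continuous :: "(real \<Rightarrow> real) \<Rightarrow> bool" where
  "locally_almost_continuous f \<longleftrightarrow>
     (\<forall>x V. f x \<in> interior V \<longrightarrow> x \<in> interior (closure (f -` V)))"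

end

theory Submission
  imports Defs
begin

text \<open>
  The reason is a property of every \<open>\<tau>\<^sub>\<rat>\<close>-open set \<open>U\<close>, applied to preimages of usual
  open sets: every point \<open>a\<close> of \<open>U\<close> lies in the usual
  interior of the usual closure of \<open>U\<close>.  This is a Baire
  category argument.  By definition, each direction \<open>x \<noteq> 0\<close> comes with
  some \<open>n\<close> such that \<open>a + q x \<in> U\<close> for all rational \<open>q\<close> in \<open>(0, 1/(n+1))\<close>.  There are only
  countably many \<open>n\<close>, so on each of the two half-lines of directions one \<open>n\<close> serves a set of
  directions that is dense in some interval \<open>I\<close>.  Then \<open>a + q I\<close> lies in the closure of
  \<open>U\<close> for all these \<open>q\<close>, and already the rational multiples \<open>q I\<close> with
  \<open>0 < q < 1/(n+1)\<close> fill an interval with endpoint \<open>0\<close>.  The positive and the negative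
  directions together yield a usual neighbourhood of \<open>a\<close> (lemma
  \<open>tauQ_open_subset_interior_closure\<close>).
\<close>

lemma Baire_countable_cover:
  fixes A :: "nat \<Rightarrow> 'a::{real_normed_vector,heine_borel} set"
  assumes "(\<Union>n. A n) = UNIV"
  shows "\<exists>n. interior (closure (A n)) \<noteq> {}"
proof (rule ccontr)
  assume "\<not> ?thesis"
  then have "UNIV \<subseteq> closure (\<Inter> (range (\<lambda>n. - closure (A n))))"
    by (intro Baire) (auto simp: closure_complement)
  moreover have "\<Inter> (range (\<lambda>n. - closure (A n))) = {}"
    using assms closure_subset by blast
  ultimately show False by simp
qed

text \<open>
  Directions on the half-line of \<open>d\<close> are written as \<open>exp y * d\<close>, so that they are
  parametrised by the whole real line and the category theorem applies to all of it.
\<close>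
lemma tauQ_open_closure_one_sided:
  assumes U: "tauQ_open U" and a: "a \<in> U" and d: "d \<noteq> 0"
  shows "\<exists>\<delta>>0. \<forall>t. 0 < t \<and> t < \<delta> \<longrightarrow> a + t * d \<in> closure U"
proof -
  define A where
    "A n = {y. \<forall>q\<in>\<rat>. 0 < q \<and> q < 1 / real (Suc n) \<longrightarrow> a + q * (exp y * d) \<in> U}" for n
  have "\<exists>n. y \<in> A n" for y
  proof -
    obtain e where e: "e > 0" "\<forall>q\<in>\<rat>. 0 < q \<and> q < e \<longrightarrow> a + q * (exp y * d) \<in> U"
      using U a d unfolding tauQ_open_def by (metis exp_not_eq_zero mult_eq_0_iff)
    obtain n where "1 / real (Suc n) < e"
      using e(1) nat_approx_posE by blast
    then have "y \<in> A n" using e(2) unfolding A_def by force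
    then show ?thesis ..
  qed
  then have "(\<Union>n. A n) = UNIV" by blast
  then obtain n y0 where "y0 \<in> interior (closure (A n))"
    using Baire_countable_cover by blast
  then obtain e where e: "e > 0" "ball y0 e \<subseteq> closure (A n)"
    using mem_interior by blast
  have "a + t * d \<in> closure U" if t: "0 < t" "t < exp y0 / real (Suc n)" for t
  proof -
    \<comment> \<open>The point \<open>t\<close> equals \<open>q * exp y\<close> with \<open>y\<close> in \<open>(y0, y0 + e)\<close> exactly when \<open>q\<close>
      lies between the following two bounds.\<close>
    have "t * exp (- (y0 + e)) < t * exp (- y0)"
      using t e by simp
    then obtain q where q: "q \<in> \<rat>" "t * exp (- (y0 + e)) < q" "q < t * exp (- y0)"
      using Rats_dense_in_real by blast
    have q0: "0 < q"
      using q(2) t(1) by (meson exp_gt_zero less_trans mult_pos_pos)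
    have "t * exp (- y0) < 1 / real (Suc n)"
      using t(2) by (simp add: exp_minus field_simps)
    then have qn: "q < 1 / real (Suc n)" using q(3) by linarith
    define y where "y = ln (t / q)"
    have tq: "t = q * exp y" using t q0 by (simp add: y_def)
    have "q * exp (y - (y0 + e)) < q * 1" "q * 1 < q * exp (y - y0)"
      using q(2,3) by (simp_all add: tq exp_diff exp_minus exp_add divide_inverse mult.assoc)
    then have "y0 < y" "y < y0 + e"
      using q0 by (simp_all only: mult_less_cancel_left_pos exp_less_one_iff one_less_exp_iff)
    then have "y \<in> closure (A n)"
      using e(2) by (auto simp: dist_real_def)
    moreover have "(\<lambda>y. a + q * (exp y * d)) ` closure (A n) \<subseteq> closure U"
    proof (rule image_closure_subset)
      show "(\<lambda>y. a + q * (exp y * d)) ` A n \<subseteq> closure U"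
        using q(1) q0 qn closure_subset unfolding A_def by blast
    qed (auto intro!: continuous_intros)
    ultimately have "a + q * (exp y * d) \<in> closure U" by blast
    then show ?thesis by (simp add: tq mult.assoc)
  qed
  then show ?thesis
    by (intro exI[of _ "exp y0 / real (Suc n)"]) auto
qed

lemma tauQ_open_subset_interior_closure:
  assumes "tauQ_open U"
  shows "U \<subseteq> interior (closure U)"
proof
  fix a assume a: "a \<in> U"
  obtain r where r: "r > 0" "\<And>t. 0 < t \<Longrightarrow> t < r \<Longrightarrow> a + t * 1 \<in> closure U"
    using tauQ_open_closure_one_sided[OF assms a, of 1] by auto
  obtain l where l: "l > 0" "\<And>t. 0 < t \<Longrightarrow> t < l \<Longrightarrow> a + t * (-1) \<in> closure U"
    using tauQ_open_closure_one_sided[OF assms a, of "-1"] by auto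
  have "b \<in> closure U" if b: "b \<in> ball a (min l r)" for b
  proof -
    consider "b = a" | "a < b" "b - a < r" | "b < a" "a - b < l"
      using b unfolding mem_ball dist_real_def by linarith
    then show ?thesis
    proof cases
      case 1 then show ?thesis using a closure_subset by blast
    next
      case 2 then show ?thesis using r(2)[of "b - a"] by simp
    next
      case 3 then show ?thesis using l(2)[of "a - b"] by simp
    qed
  qed
  then show "a \<in> interior (closure U)"
    using l(1) r(1) by (intro interiorI[of "ball a (min l r)"]) auto
qed

theorem theorem4p5:
  fixes f :: "real \<Rightarrow> real"
  assumes "tauQ_continuous f"
  shows "locally_almost_continuous f"
  unfolding locally_almost_continuous_def
proof (intro allI impI)
  fix x V assume x: "f x \<in> interior V"
  have "tauQ_open (f -` interior V)"
    using assms openin_continuous_map_preimage[of tauQ euclidean f "interior V"]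
    by (simp add: topspace_tauQ openin_tauQ vimage_def)
  then have "x \<in> interior (closure (f -` interior V))"
    using tauQ_open_subset_interior_closure x by blast
  also have "\<dots> \<subseteq> interior (closure (f -` V))"
    by (intro interior_mono closure_mono vimage_mono interior_subset)
  finally show "x \<in> interior (closure (f -` V))" .
qed

end
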